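(* Let $G$ be an $nK_2$-free graph for some $n\geq 1$. Then for every $s \geq 1$ and every $s$-fold product $e_1\cdots e_s$ of edges of $G$ (not necessarily distinct), the graph $G'$ associated to the polarization $\widetilde{(I(G)^{s+1}:e_1\cdots e_s)}$ is $nK_2$-free.
   Context: Graphs are finite, simple and undirected. For a graph $G$ with vertex set $\{x_1,\ldots,x_m\}$ and a field $k$, the edge ideal is $I(G) = (x_ix_j \mid \{x_i,x_j\}\in E(G)) \subseteq k[x_1,\ldots,x_m]$. An edge $e=\{x_i,x_j\}$ is identified with the monomial $x_ix_j$. The polarization of a monomial $x_1^{a_1}\cdots x_m^{a_m}$ is the squarefree monomial $x_{11}\cdots x_{1a_1}x_{21}\cdots x_{2a_2}\cdots x_{m1}\cdots x_{ma_m}$ in a larger polynomial ring, and the polarization $\widetilde{I}$ of a monomial ideal $I$ is generated by the polarizations of its minimal monomial generators ($x_{i1}$ being identified with $x_i$). By a theorem of Banerjee, $(I(G)^{s+1}:e_1\cdots e_s)$ is minimally generated by monomials of degree 2 (possibly squares $x_i^2$), so its polarization is a squarefree quadratic monomial ideal and hence is the edge ideal of a graph $G'$, whose vertices are those of $G$ together with one new vertex for each generator $x_i^2$ (polarized as $x_i$ times the new variable); $G$ is a subgraph of $G'$. A set of $n$ pairwise disjoint edges $\{f_1,\ldots,f_n\}$ forms an $nK_2$ in $G$ if $G$ has no edge with one endpoint in $f_i$ and the other in $f_j$ for any $i\neq j$. A graph without an $nK_2$ is called $nK_2$-free. *)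

theory Defs
  imports Complex_Main "HOL-Library.Poly_Mapping"
begin

definition simple_graph :: "'v set \<Rightarrow> 'v set set \<Rightarrow> bool" where
  "simple_graph V E \<longleftrightarrow> finite V \<and> (\<forall>e\<in>E. e \<subseteq> V \<and> card e = 2)"

definition forms_nK2 :: "nat \<Rightarrow> 'v set set \<Rightarrow> 'v set set \<Rightarrow> bool" where
  "forms_nK2 n E F \<longleftrightarrow> F \<subseteq> E \<and> finite F \<and> card F = n \<and>
     (\<forall>f\<in>F. \<forall>g\<in>F. f \<noteq> g \<longrightarrow> f \<inter> g = {} \<and> (\<forall>x\<in>f. \<forall>y\<in>g. {x, y} \<notin> E))"

definition nK2_free :: "nat \<Rightarrow> 'v set set \<Rightarrow> bool" where
  "nK2_free n E \<longleftrightarrow> \<not> (\<exists>F. forms_nK2 n E F)"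

text \<open>
  The polynomial ring over \<open>'k\<close> whose variables are the elements of \<open>'v\<close>; a monomial is
  given by its exponent function \<open>'v \<Rightarrow>\<^sub>0 nat\<close>.
\<close>
type_synonym ('v, 'k) mpoly = "('v \<Rightarrow>\<^sub>0 nat) \<Rightarrow>\<^sub>0 'k"

definition monom :: "('v \<Rightarrow>\<^sub>0 nat) \<Rightarrow> ('v, 'k::field) mpoly" where
  "monom t = Poly_Mapping.single t 1"

definition Var :: "'v \<Rightarrow> ('v, 'k::field) mpoly" where
  "Var v = monom (Poly_Mapping.single v 1)"

text \<open>Ideals of a commutative ring are the submodules of the ring viewed as a module over itself.\<close>
definition ideal_gen :: "'a::comm_ring_1 set \<Rightarrow> 'a set" where
  "ideal_gen S = module.span (*) S"

lemma module_mult: "module ((*) :: 'a::comm_ring_1 \<Rightarrow> 'a \<Rightarrow> 'a)"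
  by unfold_locales (simp_all add: algebra_simps)

definition ideal_power :: "'a::comm_ring_1 set \<Rightarrow> nat \<Rightarrow> 'a set" where
  "ideal_power I n = ideal_gen {\<Prod>i<n. a i |a. \<forall>i<n. a i \<in> I}"

definition ideal_colon :: "'a::comm_ring_1 set \<Rightarrow> 'a \<Rightarrow> 'a set" where
  "ideal_colon I f = {g. g * f \<in> I}"

definition edge_monomial :: "'v set \<Rightarrow> ('v, 'k::field) mpoly" where
  "edge_monomial e = (\<Prod>v\<in>e. Var v)"

definition edge_ideal :: "'v set set \<Rightarrow> ('v, 'k::field) mpoly set" where
  "edge_ideal E = ideal_gen (edge_monomial ` E)"

lemma monom_mem_ideal_gen:
  assumes "monom m \<in> ideal_gen ((monom :: _ \<Rightarrow> ('v, 'k::field) mpoly) ` T)"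
  shows "\<exists>t\<in>T. \<forall>v. poly_mapping.lookup t v \<le> poly_mapping.lookup m v"
proof -
  interpret module "(*) :: ('v, 'k) mpoly \<Rightarrow> _" by (rule module_mult)
  let ?S = "{p :: ('v, 'k) mpoly. \<forall>m\<in>Poly_Mapping.keys p.
    \<exists>t\<in>T. \<forall>v. poly_mapping.lookup t v \<le> poly_mapping.lookup m v}"
  have "subspace ?S"
  proof (rule subspaceI)
    show "0 \<in> ?S" by simp
  next
    fix p q assume "p \<in> ?S" "q \<in> ?S"
    then show "p + q \<in> ?S" using Poly_Mapping.keys_add[of p q] by blast
  next
    fix c p assume p: "p \<in> ?S"
    show "c * p \<in> ?S"
    proof safe
      fix m assume "m \<in> Poly_Mapping.keys (c * p)"
      then obtain a b where ab: "m = a + b" "b \<in> Poly_Mapping.keys p" using keys_mult[of c p] by blast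
      then obtain t where "t \<in> T" "\<forall>v. poly_mapping.lookup t v \<le> poly_mapping.lookup b v" using p by blast
      then show "\<exists>t\<in>T. \<forall>v. poly_mapping.lookup t v \<le> poly_mapping.lookup m v"
        using ab by (auto simp: Poly_Mapping.lookup_add trans_le_add2 intro!: bexI[of _ t])
    qed
  qed
  moreover have "monom ` T \<subseteq> ?S" by (auto simp: monom_def)
  ultimately have "ideal_gen (monom ` T) \<subseteq> ?S" unfolding ideal_gen_def by (intro span_minimal)
  then have "monom m \<in> ?S" using assms by blast
  then show ?thesis by (simp add: monom_def)
qed

lemma edge_monomial_eq:
  assumes "finite e"
  shows "edge_monomial e = monom (\<Sum>v\<in>e. Poly_Mapping.single v 1)"
  unfolding edge_monomial_def using assms
  by (induction e rule: finite_induct) (simp_all add: Var_def monom_def mult_single)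

lemma lookup_edge_exponent:
  assumes "finite e"
  shows "poly_mapping.lookup (\<Sum>v\<in>e. Poly_Mapping.single v (1::nat)) w = (if w \<in> e then 1 else 0)"
  using assms by (induction e rule: finite_induct) (auto simp: lookup_add lookup_single when_def)

lemma edge_ideal_subset:
  assumes E: "simple_graph V E" and F: "simple_graph W F"
    and eq: "(edge_ideal E :: ('v, 'k::field) mpoly set) \<subseteq> edge_ideal F"
  shows "E \<subseteq> F"
proof
  fix e assume e: "e \<in> E"
  interpret module "(*) :: ('v, 'k) mpoly \<Rightarrow> _" by (rule module_mult)
  let ?x = "\<lambda>e. \<Sum>v\<in>e. Poly_Mapping.single v (1::nat)"
  have fin: "finite e" "\<And>f. f \<in> F \<Longrightarrow> finite f"
    using E F e unfolding simple_graph_def by (meson finite_subset)+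
  have im: "edge_monomial ` F = (monom :: _ \<Rightarrow> ('v, 'k) mpoly) ` (?x ` F)"
    unfolding image_image by (rule image_cong) (simp_all add: edge_monomial_eq fin)
  have "(edge_monomial e :: ('v, 'k) mpoly) \<in> edge_ideal E"
    unfolding edge_ideal_def ideal_gen_def using e by (intro span_base) auto
  then have "(monom (?x e) :: ('v, 'k) mpoly) \<in> ideal_gen (monom ` (?x ` F))"
    using eq fin im by (auto simp: edge_monomial_eq edge_ideal_def)
  from monom_mem_ideal_gen[OF this] obtain f
    where f: "f \<in> F" "\<forall>v. poly_mapping.lookup (?x f) v \<le> poly_mapping.lookup (?x e) v" by blast
  have "f \<subseteq> e"
  proof
    fix v assume "v \<in> f"
    then show "v \<in> e"
      using f(2)[rule_format, of v] fin f(1) unfolding lookup_edge_exponent[OF fin(1)]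
        lookup_edge_exponent[OF fin(2)[OF f(1)]] by (auto split: if_splits)
  qed
  moreover have "card e = 2" "card f = 2" using E F e f unfolding simple_graph_def by auto
  ultimately have "f = e" using fin by (metis card_subset_eq)
  then show "e \<in> F" using f by simp
qed

text \<open>
  Exponents of the minimal monomial generators of a monomial ideal: the monomials of the ideal
  that are minimal with respect to divisibility.
\<close>
definition min_gens :: "('v, 'k::field) mpoly set \<Rightarrow> ('v \<Rightarrow>\<^sub>0 nat) set" where
  "min_gens I = {t. monom t \<in> I \<and>
     (\<forall>u. monom u \<in> I \<and> (\<forall>v. poly_mapping.lookup u v \<le> poly_mapping.lookup t v) \<longrightarrow> u = t)}"

text \<open>
  The variable \<open>(v, j)\<close>, for \<open>j \<ge> 1\<close>, is the \<open>j\<close>-th polarization variable belonging to \<open>v\<close>;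
  \<open>(v, 1)\<close> is identified with \<open>v\<close> itself. Variables \<open>(v, 0)\<close> never occur.
\<close>
definition polarize_monomial :: "('v \<Rightarrow>\<^sub>0 nat) \<Rightarrow> ('v \<times> nat \<Rightarrow>\<^sub>0 nat)" where
  "polarize_monomial t = (\<Sum>v\<in>Poly_Mapping.keys t.
     \<Sum>j=1..poly_mapping.lookup t v. Poly_Mapping.single (v, j) 1)"

definition polarization :: "('v, 'k::field) mpoly set \<Rightarrow> ('v \<times> nat, 'k) mpoly set" where
  "polarization I = ideal_gen ((\<lambda>t. monom (polarize_monomial t)) ` min_gens I)"

text \<open>
  \<open>(V, E)\<close> is the graph associated to the polarization of \<open>I\<close>: its edge ideal is the polarization,
  and its vertices are the original ones together with one new vertex for every generator that is
  a square of a variable.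
\<close>
definition polarization_graph ::
    "('v, 'k::field) mpoly set \<Rightarrow> ('v \<times> nat) set \<Rightarrow> ('v \<times> nat) set set \<Rightarrow> bool" where
  "polarization_graph I V E \<longleftrightarrow>
     V = {(v, 1) |v. True} \<union> {(v, 2) |v. Poly_Mapping.single v 2 \<in> min_gens I} \<and>
     simple_graph V E \<and> edge_ideal E = polarization I"

lemma polarization_graph_unique:
  assumes "polarization_graph I V E" "polarization_graph I W F"
  shows "V = W \<and> E = F"
  using assms edge_ideal_subset[of V E W F] edge_ideal_subset[of W F V E]
  unfolding polarization_graph_def by (metis dual_order.refl subset_antisym)

end

theory Submission
  imports Defs
begin

text \<open>
  Everything takes place in degree two. A product \<open>x_u x_v\<close> (possibly with \<open>u = v\<close>) lies in the colon
  ideal \<open>J\<close> iff \<open>x_u x_v e_1 \<cdots> e_s\<close> is divisible by, and hence for degree reasons equal to, a product of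
  \<open>s + 1\<close> edges. Such a factorization is the same as an even connection from \<open>u\<close> to \<open>v\<close>: a walk
  \<open>u = p_0, p_1, \<dots>, p_{2k+1} = v\<close> in \<open>G\<close> whose every second step \<open>p_1 p_2, p_3 p_4, \<dots>\<close> is one of the
  \<open>e_i\<close>, with distinct indices (\<open>quadratic_mem_colon_iff\<close>). No generators of higher degree occur,
  because the polarization is assumed to be an edge ideal. Consequently every edge of \<open>G'\<close> has the form
  \<open>{(u, 1), (v, 1)}\<close>, or \<open>{(u, 1), (u, 2)}\<close> when \<open>u = v\<close>, for an evenly connected pair
  \<open>u, v\<close>, and evenly connected \<open>u \<noteq> v\<close> are adjacent in \<open>G'\<close>.

  Suppose now that \<open>G'\<close> contains an \<open>nK_2\<close>, with one walk \<open>p_0, p_1, \<dots>, p_{2k+1}\<close> for each of its edges.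
  Replace each of these edges by the first edge \<open>p_0 p_1\<close> of its walk. These edges of \<open>G\<close> form an \<open>nK_2\<close>
  in \<open>G\<close> (\<open>nK2_from_even_connections\<close>): let \<open>q\<close> be the walk of another edge. An edge \<open>p_0 q_0\<close>
  would be an edge of \<open>G'\<close>. If \<open>p_0 q_1\<close> were an edge, then \<open>p_0, q_1, q_2, \<dots>\<close> would connect \<open>p_0\<close> to
  the end of \<open>q\<close>. If \<open>p_1 q_1\<close> were an edge, then the reverse of \<open>p\<close> down to \<open>p_1\<close>, followed by
  \<open>q_1, q_2, \<dots>\<close>, would connect the two ends, unless some index is used by both walks; but in that case
  one can change from \<open>p\<close> to \<open>q\<close> at the first shared index (\<open>even_connected_overlap\<close>). In each case two
  vertices of different edges of the \<open>nK_2\<close> would be adjacent in \<open>G'\<close>.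
\<close>

section \<open>Alternating walks\<close>

text \<open>
  The set argument records exactly which of the indexed edges \<open>e i\<close> a walk uses; since each step
  requires a fresh index, an edge can be used as often as it is repeated in the family \<open>e\<close>.
\<close>
inductive even_connected :: "'v set set \<Rightarrow> ('i \<Rightarrow> 'v set) \<Rightarrow> 'i set \<Rightarrow> 'v \<Rightarrow> 'v \<Rightarrow> bool"
  for E e where
  edge: "{u, v} \<in> E \<Longrightarrow> even_connected E e {} u v"
| step: "{u, a} \<in> E \<Longrightarrow> e i = {a, b} \<Longrightarrow> i \<notin> S \<Longrightarrow> even_connected E e S b v
    \<Longrightarrow> even_connected E e (insert i S) u v"

lemma even_connected_concat:
  assumes "even_connected E e S u a" "e i = {a, b}" "even_connected E e T b v"
    and "i \<notin> S" "i \<notin> T" "S \<inter> T = {}"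
  shows "even_connected E e (insert i (S \<union> T)) u v"
  using assms
proof (induction rule: even_connected.induct)
  case (edge u a)
  then show ?case by (auto intro: even_connected.step)
next
  case (step u c j d S a)
  have "even_connected E e (insert j (insert i (S \<union> T))) u v"
    using step by (intro even_connected.step[of u c]) auto
  then show ?case by (simp add: insert_commute)
qed

lemma even_connected_sym:
  assumes "even_connected E e S u v"
  shows "even_connected E e S v u"
  using assms
proof (induction rule: even_connected.induct)
  case (edge u v)
  then show ?case by (simp add: even_connected.edge insert_commute)
next
  case (step u a i b S v)
  have "even_connected E e (insert i (S \<union> {})) v u"
    using step by (intro even_connected_concat[of E e S v b i a])
      (auto simp: insert_commute intro: even_connected.edge)
  then show ?case by simp
qed

lemma even_connected_split:
  assumes "even_connected E e S u v" "i \<in> S"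
  shows "\<exists>a b A B. e i = {a, b} \<and> even_connected E e A u a \<and> even_connected E e B b v \<and>
    A \<subseteq> S - {i} \<and> B \<subseteq> S - {i}"
  using assms
proof (induction rule: even_connected.induct)
  case (edge u v)
  then show ?case by simp
next
  case (step u a j b S v)
  show ?case
  proof (cases "i = j")
    case True
    then have "e i = {a, b} \<and> even_connected E e {} u a \<and> even_connected E e S b v \<and>
        {} \<subseteq> insert j S - {i} \<and> S \<subseteq> insert j S - {i}"
      using step by (auto intro: even_connected.edge)
    then show ?thesis by blast
  next
    case False
    then obtain c d A B where *: "e i = {c, d}" "even_connected E e A b c"
        "even_connected E e B d v" "A \<subseteq> S - {i}" "B \<subseteq> S - {i}"
      using step by blast
    have "even_connected E e (insert j A) u c"
      using step * by (intro even_connected.step[of u a]) auto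
    moreover have "insert j A \<subseteq> insert j S - {i}" "B \<subseteq> insert j S - {i}" using * False by auto
    ultimately show ?thesis using * by blast
  qed
qed

text \<open>
  Follow the walk from \<open>u\<close> up to and including the first edge \<open>e i\<close> whose index occurs in \<open>S'\<close>, and leave
  along the other walk. This walk crosses the same edge \<open>e i\<close>, so one of its two directions
  continues the walk from \<open>u\<close>; that direction decides which of \<open>u'\<close> and \<open>v'\<close> is reached. As \<open>i\<close> is the
  first shared index, no index is used twice.
\<close>
lemma even_connected_overlap:
  assumes "even_connected E e S u v" "even_connected E e S' u' v'" "S \<inter> S' \<noteq> {}"
  shows "\<exists>T w. T \<subseteq> S \<union> S' \<and> w \<in> {u', v'} \<and> even_connected E e T u w"
  using assms
proof (induction rule: even_connected.induct)
  case (edge u v)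
  then show ?case by simp
next
  case (step u a i b S v)
  have extend: "even_connected E e (insert i T) u w"
    if "even_connected E e T b w" "i \<notin> T" for T w
    using step that by (intro even_connected.step[of u a]) auto
  show ?case
  proof (cases "i \<in> S'")
    case True
    obtain c d A B where *: "e i = {c, d}" "even_connected E e A u' c"
        "even_connected E e B d v'" "A \<subseteq> S' - {i}" "B \<subseteq> S' - {i}"
      using even_connected_split[OF step.prems(1) True] by blast
    have "b = d \<or> b = c" using * step.hyps by auto
    then show ?thesis
    proof
      assume "b = d"
      then have "even_connected E e (insert i B) u v'" using * by (intro extend) auto
      moreover have "insert i B \<subseteq> insert i S \<union> S'" using * by auto
      ultimately show ?thesis by blast
    next
      assume "b = c"
      then have "even_connected E e (insert i A) u u'"
        using * even_connected_sym by (intro extend) auto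
      moreover have "insert i A \<subseteq> insert i S \<union> S'" using * by auto
      ultimately show ?thesis by blast
    qed
  next
    case False
    then obtain T w where *: "T \<subseteq> S \<union> S'" "w \<in> {u', v'}" "even_connected E e T b w"
      using step by blast
    then have "even_connected E e (insert i T) u w" using False step.hyps by (intro extend) auto
    moreover have "insert i T \<subseteq> insert i S \<union> S'" using * by auto
    ultimately show ?thesis using * by blast
  qed
qed

text \<open>
  What remains of a walk from \<open>u\<close> to \<open>v\<close> when its first edge \<open>{u, a}\<close> is dropped. It starts with some
  \<open>e i\<close> (or is trivial), so it is not a walk in the above sense, but any edge ending in \<open>a\<close> can be
  put in front of it.
\<close>
definition walk_tail :: "'v set set \<Rightarrow> ('i \<Rightarrow> 'v set) \<Rightarrow> 'i set \<Rightarrow> 'v \<Rightarrow> 'v \<Rightarrow> bool" where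
  "walk_tail E e S a v \<longleftrightarrow> (a = v \<and> S = {}) \<or>
    (\<exists>i b T. e i = {a, b} \<and> i \<notin> T \<and> S = insert i T \<and> even_connected E e T b v)"

lemma even_connected_iff_tail:
  "even_connected E e S u v \<longleftrightarrow> (\<exists>a. {u, a} \<in> E \<and> walk_tail E e S a v)"
  by (subst even_connected.simps) (auto simp: walk_tail_def)

text \<open>
  If the second vertices \<open>a\<close> and \<open>a'\<close> are adjacent, then going back from \<open>v\<close> to \<open>a\<close>, crossing over to
  \<open>a'\<close> and going on to \<open>v'\<close> is an alternating walk, provided that the two walks share no index; if they
  do share one, the overlap lemma gives a connection instead.
\<close>
lemma even_connected_bridge:
  assumes u: "{u, a} \<in> E" and tail: "walk_tail E e S a v"
    and u': "{u', a'} \<in> E" and tail': "walk_tail E e S' a' v'"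
    and edge: "{a, a'} \<in> E"
  shows "\<exists>T x y. T \<subseteq> S \<union> S' \<and> x \<in> {u, v} \<and> y \<in> {u', v'} \<and> even_connected E e T x y"
proof (cases "S \<inter> S' = {}")
  case False
  have "even_connected E e S u v" "even_connected E e S' u' v'"
    using u tail u' tail' even_connected_iff_tail by metis+
  from even_connected_overlap[OF this False] show ?thesis by blast
next
  case disj: True
  have a: "even_connected E e S' a v'" using edge tail' even_connected_iff_tail by metis
  from tail show ?thesis unfolding walk_tail_def
  proof
    assume "a = v \<and> S = {}"
    then show ?thesis using a by blast
  next
    assume "\<exists>i b T. e i = {a, b} \<and> i \<notin> T \<and> S = insert i T \<and> even_connected E e T b v"
    then obtain i b T where *: "e i = {b, a}" "i \<notin> T" "S = insert i T" "even_connected E e T v b"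
      using even_connected_sym by (metis insert_commute)
    have "even_connected E e (insert i (T \<union> S')) v v'"
      using even_connected_concat[OF *(4,1) a *(2)] disj unfolding *(3) by simp
    moreover have "insert i (T \<union> S') \<subseteq> S \<union> S'" unfolding *(3) by simp
    ultimately show ?thesis by blast
  qed
qed

text \<open>
  The pairs \<open>l i, r i\<close> are the ends of walks whose first edges form the desired \<open>nK_2\<close>. They are
  given as indexed pairs and not as edges \<open>{l i, r i}\<close> because \<open>l i = r i\<close> occurs when the edge of the
  polarization graph comes from the square of a variable.
\<close>
lemma nK2_from_even_connections:
  assumes fin: "finite F"
    and conn: "\<And>i. i \<in> F \<Longrightarrow> \<exists>S\<subseteq>I. even_connected E e S (l i) (r i)"
    and far: "\<And>i j x y S. i \<in> F \<Longrightarrow> j \<in> F \<Longrightarrow> i \<noteq> j \<Longrightarrow> x \<in> {l i, r i} \<Longrightarrow> y \<in> {l j, r j} \<Longrightarrow>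
      S \<subseteq> I \<Longrightarrow> \<not> even_connected E e S x y"
  shows "\<exists>H. forms_nK2 (card F) E H"
proof -
  obtain S where S: "\<And>i. i \<in> F \<Longrightarrow> S i \<subseteq> I \<and> even_connected E e (S i) (l i) (r i)"
    using conn by metis
  have "\<exists>a. {l i, a} \<in> E \<and> walk_tail E e (S i) a (r i)" if "i \<in> F" for i
    using S[OF that] even_connected_iff_tail by metis
  then obtain a where a: "\<And>i. i \<in> F \<Longrightarrow> {l i, a i} \<in> E"
    "\<And>i. i \<in> F \<Longrightarrow> walk_tail E e (S i) (a i) (r i)"
    by metis
  have reroute: "even_connected E e (S i) x (r i)" if "i \<in> F" "{x, a i} \<in> E" for i x
    using a(2)[OF that(1)] that(2) even_connected_iff_tail by metis
  have apart: "{x, y} \<notin> E"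
    if ij: "i \<in> F" "j \<in> F" "i \<noteq> j" and x: "x \<in> {l i, a i}" and y: "y \<in> {l j, a j}" for i j x y
  proof
    assume xy: "{x, y} \<in> E"
    consider "x = l i" "y = l j" | "x = l i" "y = a j" | "x = a i" "y = l j" | "x = a i" "y = a j"
      using x y by blast
    then show False
    proof cases
      case 1
      then show False using far[OF ij, of "l i" "l j" "{}"] xy by (auto intro: even_connected.edge)
    next
      case 2
      then show False using far[OF ij, of "l i" "r j"] reroute[OF ij(2)] xy S ij by auto
    next
      case 3
      then have "even_connected E e (S i) (l j) (r i)"
        using reroute[OF ij(1), of "l j"] xy by (simp add: insert_commute)
      then show False using far[OF ij(2,1), of "l j" "r i"] S ij by auto
    next
      case 4
      then have aa: "{a i, a j} \<in> E" using xy by simp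
      obtain T v w where T: "T \<subseteq> S i \<union> S j" "v \<in> {l i, r i}" "w \<in> {l j, r j}" "even_connected E e T v w"
        using even_connected_bridge[OF a(1)[OF ij(1)] a(2)[OF ij(1)] a(1)[OF ij(2)] a(2)[OF ij(2)] aa]
        by metis
      have "T \<subseteq> I" using T(1) S[OF ij(1)] S[OF ij(2)] by auto
      then show False using far[OF ij T(2,3)] T(4) by simp
    qed
  qed
  define g where "g i = {l i, a i}" for i
  \<comment> \<open>If \<open>g i\<close> met \<open>g j\<close>, then \<open>g i\<close> itself would be an edge joining the two.\<close>
  have disj: "g i \<inter> g j = {}" if ij: "i \<in> F" "j \<in> F" "i \<noteq> j" for i j
  proof (rule ccontr)
    assume "g i \<inter> g j \<noteq> {}"
    then have "l i \<in> {l j, a j} \<or> a i \<in> {l j, a j}" by (auto simp: g_def)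
    then show False
      using apart[OF ij, of "l i" "a i"] apart[OF ij, of "a i" "l i"] a(1)[OF ij(1)]
      by (auto simp: insert_commute)
  qed
  have "inj_on g F"
  proof (intro inj_onI, rule ccontr)
    fix i j assume "i \<in> F" "j \<in> F" "g i = g j" "i \<noteq> j"
    then show False using disj[of i j] by (simp add: g_def)
  qed
  then have card: "card (g ` F) = card F" by (rule card_image)
  have sub: "g ` F \<subseteq> E" using a(1) by (auto simp: g_def)
  have "f \<inter> h = {} \<and> (\<forall>x\<in>f. \<forall>y\<in>h. {x, y} \<notin> E)"
    if f: "f \<in> g ` F" and h: "h \<in> g ` F" and "f \<noteq> h" for f h
  proof -
    obtain i where i: "i \<in> F" "f = g i" using f by (rule imageE)
    obtain j where j: "j \<in> F" "h = g j" using h by (rule imageE)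
    have ij: "i \<noteq> j" using \<open>f \<noteq> h\<close> i(2) j(2) by metis
    have "{x, y} \<notin> E" if "x \<in> f" "y \<in> h" for x y
      using apart[OF i(1) j(1) ij] that unfolding i(2) j(2) g_def .
    then show ?thesis using disj[OF i(1) j(1) ij] unfolding i(2) j(2) by simp
  qed
  then have "\<forall>f\<in>g ` F. \<forall>h\<in>g ` F. f \<noteq> h \<longrightarrow> f \<inter> h = {} \<and> (\<forall>x\<in>f. \<forall>y\<in>h. {x, y} \<notin> E)"
    by (intro ballI impI)
  then have "forms_nK2 (card F) E (g ` F)"
    unfolding forms_nK2_def using sub card finite_imageI[OF fin] by (intro conjI)
  then show ?thesis by (rule exI)
qed

section \<open>Monomials of the colon ideal\<close>

definition edge_exp :: "'v set \<Rightarrow> ('v \<Rightarrow>\<^sub>0 nat)" where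
  "edge_exp f = (\<Sum>v\<in>f. Poly_Mapping.single v 1)"

abbreviation exp_le :: "('v \<Rightarrow>\<^sub>0 nat) \<Rightarrow> ('v \<Rightarrow>\<^sub>0 nat) \<Rightarrow> bool" (infix "\<preceq>" 50) where
  "t \<preceq> m \<equiv> (\<forall>v. poly_mapping.lookup t v \<le> poly_mapping.lookup m v)"

lemma edge_exp_pair: "u \<noteq> v \<Longrightarrow> edge_exp {u, v} = Poly_Mapping.single u 1 + Poly_Mapping.single v 1"
  by (simp add: edge_exp_def)

lemma lookup_edge_exp: "finite f \<Longrightarrow> poly_mapping.lookup (edge_exp f) v = (if v \<in> f then 1 else 0)"
  unfolding edge_exp_def by (rule lookup_edge_exponent)

lemma edge_monomial_eq_monom: "finite f \<Longrightarrow> edge_monomial f = monom (edge_exp f)"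
  unfolding edge_exp_def by (rule edge_monomial_eq)

text \<open>
  Walking along \<open>{u, a}\<close> and then \<open>e i = {a, b}\<close> amounts to the identity
  \<open>x_u e_i = {u, a} x_b\<close> of monomials, so the edges in odd position provide the factorization.
\<close>
lemma even_connected_imp_exponents:
  assumes "even_connected E e S u v" and E: "\<And>f. f \<in> E \<Longrightarrow> card f = 2"
    and "\<And>i. i \<in> S \<Longrightarrow> card (e i) = 2"
  shows "finite S \<and> (\<exists>fs. set fs \<subseteq> E \<and> length fs = Suc (card S) \<and>
    Poly_Mapping.single u 1 + Poly_Mapping.single v 1 + (\<Sum>i\<in>S. edge_exp (e i)) = sum_list (map edge_exp fs))"
  using assms(1,3)
proof (induction rule: even_connected.induct)
  case (edge u v)
  moreover have "u \<noteq> v" using E[OF edge(1)] by auto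
  ultimately show ?case by (intro conjI exI[of _ "[{u, v}]"]) (simp_all add: edge_exp_pair)
next
  case (step u a i b S v)
  then obtain fs where fs: "finite S" "set fs \<subseteq> E" "length fs = Suc (card S)"
    "Poly_Mapping.single b 1 + Poly_Mapping.single v 1 + (\<Sum>i\<in>S. edge_exp (e i)) = sum_list (map edge_exp fs)"
    by auto
  have "u \<noteq> a" using E[OF step.hyps(1)] by auto
  moreover have "a \<noteq> b" using step.prems[of i] step.hyps by auto
  ultimately have "Poly_Mapping.single u 1 + Poly_Mapping.single v 1 + (\<Sum>j\<in>insert i S. edge_exp (e j)) =
      edge_exp {u, a} + (Poly_Mapping.single b 1 + Poly_Mapping.single v 1 + (\<Sum>j\<in>S. edge_exp (e j)))"
    using fs(1) step.hyps by (simp add: edge_exp_pair ac_simps)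
  then show ?case using fs step.hyps
    by (intro conjI exI[of _ "{u, a} # fs"]) simp_all
qed

text \<open>
  Read off the walk greedily: \<open>u\<close> lies in some factor \<open>f = {u, a}\<close> on the right. After cancelling
  \<open>f\<close>, either \<open>a = v\<close>, and the walk ends, or the variable of \<open>a\<close> on the left must come from some
  \<open>e i = {a, b}\<close>, and the same equation with \<open>b\<close> in place of \<open>u\<close> remains for \<open>S - {i}\<close>.
\<close>
lemma exponents_imp_even_connected:
  assumes "finite S" and E: "\<And>f. f \<in> E \<Longrightarrow> card f = 2" and "\<And>i. i \<in> S \<Longrightarrow> card (e i) = 2"
    and "set fs \<subseteq> E"
    and "Poly_Mapping.single u 1 + Poly_Mapping.single v 1 + (\<Sum>i\<in>S. edge_exp (e i)) = sum_list (map edge_exp fs)"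
  shows "\<exists>T\<subseteq>S. even_connected E e T u v"
  using assms(1,3-)
proof (induction S arbitrary: u fs rule: finite_psubset_induct)
  case (psubset S)
  note eq = psubset.prems(3)
  have finE: "finite f" if "f \<in> E" for f using E[OF that] by (simp add: card_ge_0_finite)
  have fine: "finite (e i)" if "i \<in> S" for i using psubset.prems(1)[OF that] by (simp add: card_ge_0_finite)
  have "poly_mapping.lookup (sum_list (map edge_exp fs)) u \<noteq> 0"
    unfolding eq[symmetric] by (simp add: lookup_add)
  then have "\<exists>f\<in>set fs. u \<in> f" using psubset.prems(2)
  proof (induction fs)
    case (Cons f fs)
    then show ?case using finE[of f] by (auto simp: lookup_add lookup_edge_exp split: if_splits)
  qed simp
  then obtain f where f: "f \<in> set fs" "u \<in> f" by blast
  then have fE: "f \<in> E" using psubset.prems by blast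
  then obtain a where a: "f = {u, a}" "u \<noteq> a" using E f(2) by (metis card_2_iff doubleton_eq_iff insertE singletonD)
  have "sum_list (map edge_exp fs) = edge_exp f + sum_list (map edge_exp (remove1 f fs))"
    using f by (simp add: sum_list_map_remove1)
  then have eq1: "Poly_Mapping.single v 1 + (\<Sum>i\<in>S. edge_exp (e i)) =
      Poly_Mapping.single a 1 + sum_list (map edge_exp (remove1 f fs))"
    using eq a by (simp add: edge_exp_pair add.assoc)
  show ?case
  proof (cases "a = v")
    case True
    then have "even_connected E e {} u v" using a fE by (auto intro: even_connected.edge)
    then show ?thesis by blast
  next
    case False
    have "poly_mapping.lookup (Poly_Mapping.single v 1 + (\<Sum>i\<in>S. edge_exp (e i))) a \<noteq> 0"
      unfolding eq1 by (simp add: lookup_add)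
    then have "(\<Sum>i\<in>S. poly_mapping.lookup (edge_exp (e i)) a) \<noteq> 0"
      using False by (simp add: lookup_add lookup_single lookup_sum)
    then obtain i where i: "i \<in> S" "poly_mapping.lookup (edge_exp (e i)) a \<noteq> 0"
      by (meson sum.neutral)
    then have "a \<in> e i" using fine by (simp add: lookup_edge_exp split: if_splits)
    then obtain b where b: "e i = {a, b}" "a \<noteq> b"
      using psubset.prems(1)[OF i(1)] by (metis card_2_iff doubleton_eq_iff insertE singletonD)
    have "(\<Sum>i\<in>S. edge_exp (e i)) = edge_exp (e i) + (\<Sum>i\<in>S - {i}. edge_exp (e i))"
      using i psubset.hyps by (simp add: sum.remove)
    then have "Poly_Mapping.single a 1 + (Poly_Mapping.single b 1 + Poly_Mapping.single v 1 + (\<Sum>i\<in>S - {i}. edge_exp (e i)))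
       = Poly_Mapping.single a 1 + sum_list (map edge_exp (remove1 f fs))"
      using eq1 b by (simp add: edge_exp_pair ac_simps)
    then have "Poly_Mapping.single b 1 + Poly_Mapping.single v 1 + (\<Sum>i\<in>S - {i}. edge_exp (e i))
       = sum_list (map edge_exp (remove1 f fs))" by (rule add_left_imp_eq)
    moreover have "S - {i} \<subset> S" using i by blast
    moreover have "set (remove1 f fs) \<subseteq> E" using psubset.prems(2) set_remove1_subset by fastforce
    ultimately obtain T where T: "T \<subseteq> S - {i}" "even_connected E e T b v"
      using psubset.IH[of "S - {i}" "remove1 f fs" b] psubset.prems(1) by auto
    then have "even_connected E e (insert i T) u v"
      using a b fE by (intro even_connected.step[of u a]) auto
    then show ?thesis using T i by blast
  qed
qed

lemma monom_add: "monom (s + t) = monom s * monom t"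
  by (simp add: monom_def mult_single)

lemma monom_sum: "monom (sum g A) = (\<Prod>i\<in>A. monom (g i))"
proof (induction A rule: infinite_finite_induct)
  case (insert x F)
  then show ?case by (simp add: monom_add)
qed (simp_all add: monom_def)

lemma exp_le_imp_add: "t \<preceq> m \<Longrightarrow> m = (m - t) + t"
  by (intro poly_mapping_eqI) (simp add: lookup_add lookup_minus)

text \<open>
  The subspace consists of the polynomials all of whose terms are divisible by a monomial in \<open>T\<close>. It
  bounds a monomial ideal from above without any description of its elements as combinations.
\<close>
lemma subspace_dominated:
  fixes T :: "('v \<Rightarrow>\<^sub>0 nat) set"
  shows "module.subspace (*) {p :: ('v, 'k::field) mpoly. \<forall>m\<in>Poly_Mapping.keys p. \<exists>t\<in>T. t \<preceq> m}"
    (is "module.subspace _ ?P")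
proof -
  interpret module "(*) :: ('v, 'k) mpoly \<Rightarrow> _" by (rule module_mult)
  show ?thesis
  proof (rule subspaceI)
    show "0 \<in> ?P" by simp
  next
    fix p q assume "p \<in> ?P" "q \<in> ?P"
    then show "p + q \<in> ?P" using Poly_Mapping.keys_add[of p q] by blast
  next
    fix c p assume p: "p \<in> ?P"
    show "c * p \<in> ?P"
    proof safe
      fix m assume "m \<in> Poly_Mapping.keys (c * p)"
      then obtain a b where ab: "m = a + b" "b \<in> Poly_Mapping.keys p" using keys_mult[of c p] by blast
      then obtain t where "t \<in> T" "t \<preceq> b" using p by blast
      then show "\<exists>t\<in>T. t \<preceq> m"
        using ab by (auto simp: lookup_add trans_le_add2 intro!: bexI[of _ t])
    qed
  qed
qed

lemma monom_mem_ideal_power_iff: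
  fixes T :: "('v \<Rightarrow>\<^sub>0 nat) set"
  shows "(monom m :: ('v, 'k::field) mpoly) \<in> ideal_power (ideal_gen (monom ` T)) n \<longleftrightarrow>
    (\<exists>ts. set ts \<subseteq> T \<and> length ts = n \<and> sum_list ts \<preceq> m)"
proof -
  interpret module "(*) :: ('v, 'k) mpoly \<Rightarrow> _" by (rule module_mult)
  let ?I = "ideal_gen (monom ` T) :: ('v, 'k) mpoly set"
  let ?sums = "\<lambda>n. {sum_list ts |ts. set ts \<subseteq> T \<and> length ts = n}"
  let ?P = "\<lambda>T. {p :: ('v, 'k) mpoly. \<forall>m\<in>Poly_Mapping.keys p. \<exists>t\<in>T. t \<preceq> m}"
  have IP: "?I \<subseteq> ?P T"
    unfolding ideal_gen_def by (intro span_minimal subspace_dominated) (auto simp: monom_def)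
  have prod: "(\<Prod>i<n. a i) \<in> ?P (?sums n)" if "\<forall>i<n. a i \<in> ?I" for a n
    using that
  proof (induction n)
    case 0
    then show ?case by auto
  next
    case (Suc n)
    show ?case
    proof safe
      fix m assume "m \<in> Poly_Mapping.keys (\<Prod>i<Suc n. a i)"
      then obtain b c where bc: "m = b + c" "b \<in> Poly_Mapping.keys (\<Prod>i<n. a i)" "c \<in> Poly_Mapping.keys (a n)"
        using keys_mult[of "\<Prod>i<n. a i" "a n"] by auto
      obtain ts where ts: "set ts \<subseteq> T" "length ts = n" "sum_list ts \<preceq> b" using Suc bc(2) by auto
      obtain t where t: "t \<in> T" "t \<preceq> c" using IP Suc.prems bc(3) by blast
      show "\<exists>t\<in>?sums (Suc n). t \<preceq> m"
      proof (rule bexI)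
        show "sum_list (t # ts) \<preceq> m"
          using add_mono[OF t(2)[rule_format] ts(3)[rule_format]] bc(1) by (simp add: lookup_add add.commute)
        show "sum_list (t # ts) \<in> ?sums (Suc n)" using ts t by (intro CollectI exI[of _ "t # ts"]) simp
      qed
    qed
  qed
  show ?thesis
  proof
    assume "(monom m :: ('v, 'k) mpoly) \<in> ideal_power ?I n"
    moreover have "ideal_power ?I n \<subseteq> ?P (?sums n)"
      unfolding ideal_power_def ideal_gen_def[of "{\<Prod>i<n. a i |a. \<forall>i<n. a i \<in> ?I}"]
      using prod by (intro span_minimal subspace_dominated) auto
    ultimately have "(monom m :: ('v, 'k) mpoly) \<in> ?P (?sums n)" by (rule rev_subsetD)
    then show "\<exists>ts. set ts \<subseteq> T \<and> length ts = n \<and> sum_list ts \<preceq> m"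
      by (auto simp: monom_def)
  next
    assume "\<exists>ts. set ts \<subseteq> T \<and> length ts = n \<and> sum_list ts \<preceq> m"
    then obtain ts where ts: "set ts \<subseteq> T" "length ts = n" "sum_list ts \<preceq> m" by blast
    have "(monom m :: ('v, 'k) mpoly) = monom (m - sum_list ts) * (\<Prod>i<n. monom (ts ! i))"
      using exp_le_imp_add[OF ts(3)] ts(2)
      by (metis monom_add monom_sum sum_list_sum_nth atLeast0LessThan)
    moreover have "\<forall>i<n. (monom (ts ! i) :: ('v, 'k) mpoly) \<in> ?I"
      unfolding ideal_gen_def using ts(1,2) nth_mem by (blast intro: span_base)
    moreover from this have "(\<Prod>i<n. (monom (ts ! i) :: ('v, 'k) mpoly)) \<in> ideal_power ?I n"
      unfolding ideal_power_def ideal_gen_def[of "{\<Prod>i<n. a i |a. \<forall>i<n. a i \<in> ?I}"]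
      by (intro span_base) blast
    ultimately show "(monom m :: ('v, 'k) mpoly) \<in> ideal_power ?I n"
      unfolding ideal_power_def ideal_gen_def[of "{\<Prod>i<n. a i |a. \<forall>i<n. a i \<in> ?I}"]
      by (simp only: span_scale)
  qed
qed

definition total_degree :: "('v::finite \<Rightarrow>\<^sub>0 nat) \<Rightarrow> nat" where
  "total_degree t = (\<Sum>v\<in>UNIV. poly_mapping.lookup t v)"

lemma total_degree_add: "total_degree (s + t) = total_degree s + total_degree t"
  by (simp add: total_degree_def lookup_add sum.distrib)

lemma total_degree_sum: "total_degree (sum g A) = (\<Sum>i\<in>A. total_degree (g i))"
  by (simp add: total_degree_def lookup_sum sum.swap[of _ A])

lemma total_degree_single: "total_degree (Poly_Mapping.single v c) = c"
  by (simp add: total_degree_def lookup_single when_def)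

lemma total_degree_edge_exp: "total_degree (edge_exp f) = card f"
  by (simp add: edge_exp_def total_degree_sum total_degree_single)

lemma total_degree_mono: "s \<preceq> t \<Longrightarrow> total_degree s \<le> total_degree t"
  by (simp add: total_degree_def sum_mono)

lemma exp_le_antisym_degree:
  fixes s t :: "'v::finite \<Rightarrow>\<^sub>0 nat"
  assumes le: "s \<preceq> t" and deg: "total_degree t \<le> total_degree s"
  shows "s = t"
proof (rule poly_mapping_eqI)
  fix v
  have "(\<Sum>v\<in>UNIV. poly_mapping.lookup s v) = (\<Sum>v\<in>UNIV. poly_mapping.lookup t v)"
    using deg total_degree_mono[OF le] by (simp add: total_degree_def)
  then show "poly_mapping.lookup s v = poly_mapping.lookup t v"
    by (rule sum_mono_inv) (use le in auto)
qed

lemma total_degree_edge_exps: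
  "(\<And>f. f \<in> set fs \<Longrightarrow> card f = 2) \<Longrightarrow> total_degree (sum_list (map edge_exp fs)) = 2 * length fs"
  for fs :: "'v::finite set list"
  by (induction fs)
    (simp_all add: total_degree_add total_degree_edge_exp, simp add: total_degree_def)

lemma edge_ideal_eq_monom:
  assumes "simple_graph V E"
  shows "edge_ideal E = ideal_gen (monom ` edge_exp ` E)"
proof -
  have "\<And>f. f \<in> E \<Longrightarrow> finite f" using assms unfolding simple_graph_def by (meson finite_subset)
  then show ?thesis unfolding edge_ideal_def image_image
    by (intro arg_cong[where f = ideal_gen] image_cong) (simp_all add: edge_monomial_eq_monom)
qed

lemma monom_mem_edge_ideal_power_colon:
  fixes J :: "('v, 'k::field) mpoly set" and e :: "'i \<Rightarrow> 'v set"
  assumes G: "simple_graph V E" and e: "\<forall>i\<in>S. e i \<in> E"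
    and J: "J = ideal_colon (ideal_power (edge_ideal E) n) (\<Prod>i\<in>S. edge_monomial (e i))"
  shows "monom t \<in> J \<longleftrightarrow> (\<exists>fs. set fs \<subseteq> E \<and> length fs = n \<and>
    sum_list (map edge_exp fs) \<preceq> t + (\<Sum>i\<in>S. edge_exp (e i)))"
proof -
  have fin: "finite f" if "f \<in> E" for f
    using G that unfolding simple_graph_def by (meson finite_subset)
  have "monom t * (\<Prod>i\<in>S. edge_monomial (e i)) = (monom (t + (\<Sum>i\<in>S. edge_exp (e i))) :: ('v, 'k) mpoly)"
    unfolding monom_add monom_sum[of "\<lambda>i. edge_exp (e i)" S]
    using e fin by (intro arg_cong2[where f = "(*)"] refl prod.cong) (simp_all add: edge_monomial_eq_monom)
  then have "monom t \<in> J \<longleftrightarrow> (\<exists>ts. set ts \<subseteq> edge_exp ` E \<and> length ts = n \<and>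
      sum_list ts \<preceq> t + (\<Sum>i\<in>S. edge_exp (e i)))"
    by (simp add: J ideal_colon_def edge_ideal_eq_monom[OF G] monom_mem_ideal_power_iff)
  also have "\<dots> \<longleftrightarrow> (\<exists>fs. set fs \<subseteq> E \<and> length fs = n \<and>
    sum_list (map edge_exp fs) \<preceq> t + (\<Sum>i\<in>S. edge_exp (e i)))"
  proof safe
    fix ts assume "set ts \<subseteq> edge_exp ` E" and le: "sum_list ts \<preceq> t + (\<Sum>i\<in>S. edge_exp (e i))"
    then have "ts \<in> map edge_exp ` lists E" by (simp add: lists_image[symmetric] in_lists_conv_set subset_iff)
    then obtain fs where "fs \<in> lists E" "ts = map edge_exp fs" by blast
    then show "\<exists>fs. set fs \<subseteq> E \<and> length fs = length ts \<and>
        sum_list (map edge_exp fs) \<preceq> t + (\<Sum>i\<in>S. edge_exp (e i))"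
      using le by (intro exI[of _ fs]) auto
  next
    fix fs assume "set fs \<subseteq> E" and "sum_list (map edge_exp fs) \<preceq> t + (\<Sum>i\<in>S. edge_exp (e i))"
    then show "\<exists>ts. set ts \<subseteq> edge_exp ` E \<and> length ts = length fs \<and>
        sum_list ts \<preceq> t + (\<Sum>i\<in>S. edge_exp (e i))"
      by (intro exI[of _ "map edge_exp fs"]) auto
  qed
  finally show ?thesis .
qed

lemma colon_degree_ge_2:
  fixes J :: "('v::finite, 'k::field) mpoly set"
  assumes G: "simple_graph UNIV E" and e: "\<forall>i\<in>S. e i \<in> E"
    and J: "J = ideal_colon (ideal_power (edge_ideal E) (card S + 1)) (\<Prod>i\<in>S. edge_monomial (e i))"
    and t: "monom t \<in> J"
  shows "2 \<le> total_degree t"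
proof -
  have E: "card f = 2" if "f \<in> E" for f using G that by (simp add: simple_graph_def)
  obtain fs where fs: "set fs \<subseteq> E" "length fs = card S + 1"
    "sum_list (map edge_exp fs) \<preceq> t + (\<Sum>i\<in>S. edge_exp (e i))"
    using t monom_mem_edge_ideal_power_colon[OF G e J] by blast
  have "total_degree (sum_list (map edge_exp fs)) = 2 * (card S + 1)"
    using fs E by (subst total_degree_edge_exps) auto
  moreover have "total_degree (\<Sum>i\<in>S. edge_exp (e i)) = 2 * card S"
    using E e by (simp add: total_degree_sum total_degree_edge_exp)
  ultimately show ?thesis using total_degree_mono[OF fs(3)] by (simp add: total_degree_add)
qed

text \<open>
  Both sides of the divisibility have degree \<open>2 (card S + 1)\<close>, so it is an equality, and the two lemmas
  translating between factorizations and walks apply. For the converse, the \<open>e i\<close> that the walk does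
  not use are added to the factorization unchanged.
\<close>
lemma quadratic_mem_colon_iff:
  fixes J :: "('v::finite, 'k::field) mpoly set"
  assumes G: "simple_graph UNIV E" and fin: "finite S" and e: "\<forall>i\<in>S. e i \<in> E"
    and J: "J = ideal_colon (ideal_power (edge_ideal E) (card S + 1)) (\<Prod>i\<in>S. edge_monomial (e i))"
  shows "monom (Poly_Mapping.single u 1 + Poly_Mapping.single v 1) \<in> J \<longleftrightarrow>
    (\<exists>T\<subseteq>S. even_connected E e T u v)"
proof -
  let ?uv = "Poly_Mapping.single u 1 + Poly_Mapping.single v (1::nat)"
  have E: "card f = 2" if "f \<in> E" for f using G that by (simp add: simple_graph_def)
  have e2: "card (e i) = 2" if "i \<in> S" for i using E e that by blast
  show ?thesis
  proof
    assume "monom ?uv \<in> J"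
    then obtain fs where fs: "set fs \<subseteq> E" "length fs = card S + 1"
      "sum_list (map edge_exp fs) \<preceq> ?uv + (\<Sum>i\<in>S. edge_exp (e i))"
      using monom_mem_edge_ideal_power_colon[OF G e J] by blast
    have "total_degree (sum_list (map edge_exp fs)) = 2 * (card S + 1)"
      using fs E by (subst total_degree_edge_exps) auto
    moreover have "total_degree (\<Sum>i\<in>S. edge_exp (e i)) = 2 * card S"
      using e2 by (simp add: total_degree_sum total_degree_edge_exp)
    ultimately have "sum_list (map edge_exp fs) = ?uv + (\<Sum>i\<in>S. edge_exp (e i))"
      using fs(3) by (intro exp_le_antisym_degree) (auto simp: total_degree_add total_degree_single)
    then show "\<exists>T\<subseteq>S. even_connected E e T u v"
      using fs(1) E e2 fin by (intro exponents_imp_even_connected[of S E e fs]) auto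
  next
    assume "\<exists>T\<subseteq>S. even_connected E e T u v"
    then obtain T where T: "T \<subseteq> S" "even_connected E e T u v" by blast
    then obtain fs where fs: "set fs \<subseteq> E" "length fs = Suc (card T)"
      "?uv + (\<Sum>i\<in>T. edge_exp (e i)) = sum_list (map edge_exp fs)"
      using even_connected_imp_exponents[of E e T u v] E e2 by blast
    obtain js where js: "set js = S - T" "distinct js"
      using finite_distinct_list fin by (metis finite_Diff)
    define gs where "gs = fs @ map e js"
    have len: "length js = card S - card T" "card T \<le> card S"
      using js T fin distinct_card[of js] by (auto simp: card_Diff_subset finite_subset card_mono)
    have "sum_list (map edge_exp gs) = ?uv + (\<Sum>i\<in>T. edge_exp (e i)) + (\<Sum>i\<in>S - T. edge_exp (e i))"
      using js fs(3) by (simp add: gs_def comp_def sum_list_distinct_conv_sum_set)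
    also have "\<dots> = ?uv + (\<Sum>i\<in>S. edge_exp (e i))"
      using sum.subset_diff[OF T(1) fin, of "\<lambda>i. edge_exp (e i)"] by (simp add: ac_simps)
    finally have "sum_list (map edge_exp gs) = ?uv + (\<Sum>i\<in>S. edge_exp (e i))" .
    moreover have "set gs \<subseteq> E" "length gs = card S + 1"
      using fs js e len by (auto simp: gs_def)
    ultimately show "monom ?uv \<in> J"
      using monom_mem_edge_ideal_power_colon[OF G e J] by (metis order_refl)
  qed
qed

section \<open>Edges of the polarization graph\<close>

lemma lookup_polarize_monomial:
  "poly_mapping.lookup (polarize_monomial t) (v, j) =
    (if 1 \<le> j \<and> j \<le> poly_mapping.lookup t v then 1 else 0)"
proof -
  have "poly_mapping.lookup (polarize_monomial t) (v, j) =
      (\<Sum>w\<in>Poly_Mapping.keys t. \<Sum>k=1..poly_mapping.lookup t w. if w = v \<and> k = j then 1 else 0)"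
    unfolding polarize_monomial_def lookup_sum
    by (intro sum.cong refl) (auto simp: lookup_single when_def)
  also have "\<dots> = (\<Sum>w\<in>Poly_Mapping.keys t. if w = v then
      (if 1 \<le> j \<and> j \<le> poly_mapping.lookup t v then 1 else 0) else 0)"
    by (intro sum.cong refl) auto
  also have "\<dots> = (if 1 \<le> j \<and> j \<le> poly_mapping.lookup t v then 1 else 0)"
    by (auto simp: in_keys_iff)
  finally show ?thesis .
qed

lemma edge_exp_le_imp_eq:
  assumes "edge_exp f \<preceq> edge_exp g" "card f = 2" "card g = 2"
  shows "f = g"
proof -
  have fin: "finite f" "finite g" using assms(2,3) by (simp_all add: card_ge_0_finite)
  have "f \<subseteq> g"
  proof
    fix v assume "v \<in> f"
    then show "v \<in> g" using assms(1)[rule_format, of v] fin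
      by (simp add: lookup_edge_exp split: if_splits)
  qed
  then show ?thesis using assms fin by (simp add: card_subset_eq)
qed

lemma polarization_graph_generator:
  fixes J :: "('v, 'k::field) mpoly set"
  assumes "polarization_graph J V' E'" "t \<in> min_gens J"
  shows "\<exists>f\<in>E'. edge_exp f \<preceq> polarize_monomial t"
proof -
  interpret module "(*) :: ('v \<times> nat, 'k) mpoly \<Rightarrow> _" by (rule module_mult)
  have G': "simple_graph V' E'" and eq: "edge_ideal E' = polarization J"
    using assms by (auto simp: polarization_graph_def)
  have "(monom (polarize_monomial t) :: (_, 'k) mpoly) \<in> polarization J"
    unfolding polarization_def ideal_gen_def using assms by (intro span_base) auto
  then have "(monom (polarize_monomial t) :: (_, 'k) mpoly) \<in> ideal_gen (monom ` edge_exp ` E')"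
    using eq edge_ideal_eq_monom[OF G'] by metis
  then show ?thesis using monom_mem_ideal_gen by blast
qed

text \<open>
  The edges of the graph and the polarized generators generate the same ideal. Hence \<open>f\<close> is divisible by
  some polarized generator, which is in turn divisible by an edge; that edge lies in \<open>f\<close> and therefore
  equals \<open>f\<close>, so the generator does as well.
\<close>
lemma polarization_graph_edge:
  fixes J :: "('v, 'k::field) mpoly set"
  assumes pol: "polarization_graph J V' E'" and f: "f \<in> E'"
  shows "\<exists>t\<in>min_gens J. polarize_monomial t = edge_exp f"
proof -
  interpret module "(*) :: ('v \<times> nat, 'k) mpoly \<Rightarrow> _" by (rule module_mult)
  have G': "simple_graph V' E'" and eq: "edge_ideal E' = polarization J"
    using assms by (auto simp: polarization_graph_def)
  have "(monom (edge_exp f) :: (_, 'k) mpoly) \<in> ideal_gen (monom ` edge_exp ` E')"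
    unfolding ideal_gen_def using f by (intro span_base) auto
  then have "(monom (edge_exp f) :: (_, 'k) mpoly) \<in> ideal_gen (monom ` polarize_monomial ` min_gens J)"
    using eq edge_ideal_eq_monom[OF G'] unfolding polarization_def image_image by metis
  then obtain t where t: "t \<in> min_gens J" "polarize_monomial t \<preceq> edge_exp f"
    using monom_mem_ideal_gen by blast
  obtain g where g: "g \<in> E'" "edge_exp g \<preceq> polarize_monomial t"
    using polarization_graph_generator[OF pol t(1)] by blast
  then have "edge_exp g \<preceq> edge_exp f" using t order_trans by blast
  then have "g = f" using G' g f by (intro edge_exp_le_imp_eq) (auto simp: simple_graph_def)
  then have "polarize_monomial t = edge_exp f" using t g by (intro poly_mapping_eqI antisym) auto
  then show ?thesis using t by blast
qed

text \<open>
  A generator whose polarization has degree two has degree two itself. The variable \<open>(w, 1)\<close> divides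
  the polarization whenever some \<open>(w, k)\<close> does, and this puts \<open>(u, 1)\<close> and \<open>(v, 1)\<close> into \<open>f\<close>. The
  inclusion is proper exactly if \<open>u = v\<close>, when \<open>f = {(u, 1), (u, 2)}\<close>.
\<close>
lemma polarization_graph_edge_quadratic:
  fixes J :: "('v, 'k::field) mpoly set"
  assumes pol: "polarization_graph J V' E'" and f: "f \<in> E'"
  shows "\<exists>u v. monom (Poly_Mapping.single u 1 + Poly_Mapping.single v 1) \<in> J \<and> {(u, 1), (v, 1)} \<subseteq> f"
proof -
  have G': "simple_graph V' E'" using pol unfolding polarization_graph_def by blast
  obtain t where t: "t \<in> min_gens J" "polarize_monomial t = edge_exp f"
    using polarization_graph_edge[OF assms] by blast
  have cf: "card f = 2" using G' f by (auto simp: simple_graph_def)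
  then have fin: "finite f" by (intro card_ge_0_finite) simp
  have mem: "(w, k) \<in> f \<longleftrightarrow> 1 \<le> k \<and> k \<le> poly_mapping.lookup t w" for w k
  proof -
    have "poly_mapping.lookup (polarize_monomial t) (w, k) = poly_mapping.lookup (edge_exp f) (w, k)"
      by (simp only: t(2))
    then show ?thesis
      unfolding lookup_polarize_monomial lookup_edge_exp[OF fin] by (metis zero_neq_one)
  qed
  obtain u i v j where uv: "f = {(u, i), (v, j)}" "(u, i) \<noteq> (v, j)"
    using cf by (metis card_2_iff surj_pair)
  have first: "(w, 1) \<in> f" if "(w, k) \<in> f" for w k
    using that unfolding mem by linarith
  have "(u, i) \<in> f" "(v, j) \<in> f" unfolding uv(1) by simp_all
  then have u1: "(u, 1) \<in> f" and v1: "(v, 1) \<in> f" by (blast intro: first)+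
  have "t = Poly_Mapping.single u 1 + Poly_Mapping.single v 1"
  proof (rule poly_mapping_eqI)
    fix w
    \<comment> \<open>The exponent of \<open>w\<close> is the number of polarization variables of \<open>w\<close> in \<open>f\<close>.\<close>
    have "{k. (w, k) \<in> f} = {1..poly_mapping.lookup t w}" unfolding mem by auto
    then have "card {k. (w, k) \<in> f} = poly_mapping.lookup t w" by simp
    moreover have "{k. (w, k) \<in> f} = (if w = u then {i} else {}) \<union> (if w = v then {j} else {})"
      using uv(1) by auto
    ultimately show "poly_mapping.lookup t w =
        poly_mapping.lookup (Poly_Mapping.single u 1 + Poly_Mapping.single v 1) w"
      using uv(2) by (auto simp: lookup_add lookup_single when_def split: if_splits)
  qed
  then have "monom (Poly_Mapping.single u 1 + Poly_Mapping.single v 1) \<in> J"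
    using t(1) by (simp add: min_gens_def)
  then show ?thesis using u1 v1 by blast
qed

text \<open>
  The degree bound makes the squarefree quadratic monomial a minimal generator of \<open>J\<close>, and it is its own
  polarization.
\<close>
lemma polarization_graph_edgeI:
  fixes J :: "('v::finite, 'k::field) mpoly set"
  assumes pol: "polarization_graph J V' E'"
    and deg: "\<And>t. monom t \<in> J \<Longrightarrow> 2 \<le> total_degree t"
    and uv: "monom (Poly_Mapping.single u 1 + Poly_Mapping.single v 1) \<in> J" "u \<noteq> v"
  shows "{(u, 1), (v, 1)} \<in> E'"
proof -
  let ?t = "Poly_Mapping.single u 1 + Poly_Mapping.single v (1::nat)"
  have G': "simple_graph V' E'" using pol unfolding polarization_graph_def by blast
  have "w = ?t" if "monom w \<in> J" "w \<preceq> ?t" for w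
    using that(2) deg[OF that(1)]
    by (intro exp_le_antisym_degree) (simp_all add: total_degree_add total_degree_single)
  then have "?t \<in> min_gens J" unfolding min_gens_def using uv(1) by blast
  then obtain f where f: "f \<in> E'" "edge_exp f \<preceq> polarize_monomial ?t"
    using polarization_graph_generator[OF pol] by blast
  have "polarize_monomial ?t = edge_exp {(u, 1), (v, 1)}"
  proof (rule poly_mapping_eqI)
    fix p
    show "poly_mapping.lookup (polarize_monomial ?t) p = poly_mapping.lookup (edge_exp {(u, 1), (v, 1)}) p"
      using uv(2) by (cases p) (auto simp: lookup_polarize_monomial lookup_add lookup_single when_def lookup_edge_exp)
  qed
  then have "f = {(u, 1), (v, 1)}"
    using f G' uv(2) by (intro edge_exp_le_imp_eq) (auto simp: simple_graph_def)
  then show ?thesis using f by simp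
qed

theorem corollary4p7:
  fixes E :: "'v::finite set set"
    and V' :: "('v \<times> nat) set" and E' :: "('v \<times> nat) set set"
    and n s :: nat and e :: "nat \<Rightarrow> 'v set"
    and J :: "('v, 'k::field) mpoly set"
  assumes "simple_graph (UNIV :: 'v set) E"
    and "n \<ge> 1" and "nK2_free n E"
    and "s \<ge> 1" and "\<forall>i\<in>{1..s}. e i \<in> E"
    and "J = ideal_colon (ideal_power (edge_ideal E) (s + 1)) (\<Prod>i=1..s. edge_monomial (e i))"
    and "polarization_graph J V' E'"
  shows "nK2_free n E'"
  unfolding nK2_free_def
proof
  note pol = assms(7)
  have J: "J = ideal_colon (ideal_power (edge_ideal E) (card {1..s} + 1)) (\<Prod>i=1..s. edge_monomial (e i))"
    using assms(6) by simp
  note quadratic = quadratic_mem_colon_iff[OF assms(1) finite_atLeastAtMost assms(5) J]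
  note degree = colon_degree_ge_2[OF assms(1,5) J]
  assume "\<exists>F. forms_nK2 n E' F"
  then obtain F where F: "F \<subseteq> E'" "finite F" "card F = n"
    and F_disj: "\<And>f g. f \<in> F \<Longrightarrow> g \<in> F \<Longrightarrow> f \<noteq> g \<Longrightarrow> f \<inter> g = {}"
    and F_far: "\<And>f g x y. f \<in> F \<Longrightarrow> g \<in> F \<Longrightarrow> f \<noteq> g \<Longrightarrow> x \<in> f \<Longrightarrow> y \<in> g \<Longrightarrow> {x, y} \<notin> E'"
    unfolding forms_nK2_def by metis
  obtain l r where lr: "\<And>f. f \<in> F \<Longrightarrow> monom (Poly_Mapping.single (l f) 1 + Poly_Mapping.single (r f) 1) \<in> J"
      "\<And>f. f \<in> F \<Longrightarrow> {(l f, 1), (r f, 1)} \<subseteq> f"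
    using polarization_graph_edge_quadratic[OF pol] F(1) by (metis subsetD)
  have "\<exists>H. forms_nK2 (card F) E H"
  proof (rule nK2_from_even_connections[OF F(2), of "{1..s}" E e l r])
    fix f assume "f \<in> F"
    then show "\<exists>S\<subseteq>{1..s}. even_connected E e S (l f) (r f)" using lr(1) quadratic by blast
  next
    fix f g x y S
    assume fg: "f \<in> F" "g \<in> F" "f \<noteq> g" and xy: "x \<in> {l f, r f}" "y \<in> {l g, r g}" and S: "S \<subseteq> {1..s}"
    have mem: "(x, 1) \<in> f" "(y, 1) \<in> g" using lr(2) fg xy by auto
    show "\<not> even_connected E e S x y"
    proof
      assume "even_connected E e S x y"
      then have "monom (Poly_Mapping.single x 1 + Poly_Mapping.single y 1) \<in> J"
        using S quadratic by blast
      moreover have "x \<noteq> y" using F_disj[OF fg] mem by blast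
      ultimately have "{(x, 1), (y, 1)} \<in> E'" using polarization_graph_edgeI[OF pol degree] by blast
      then show False using F_far[OF fg mem] by blast
    qed
  qed
  then show False using assms(3) F(3) by (simp add: nK2_free_def)
qed

end
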